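(* Let $\Xi\subset\mathbb R^d$ be compact, convex and full-dimensional, and let $B$, $D$, $H$, $\rho(\cdot)$, $\phi(\cdot)$ be as defined in the context. (i) For any $\Lambda,\Gamma\in\mathcal M_+(\Xi)$, $B(\Lambda,\Gamma)=\rho(\Lambda)\,D(\phi(\Lambda),\phi(\Gamma))+H(\rho(\Lambda),\rho(\Gamma))$. (ii) For any two non-negative measures $\Lambda,\Gamma\in\mathcal M_+(\Xi)$, $B(\Lambda,\Gamma)$ is non-negative. Further, $B(\Lambda,\Gamma)=0$ if and only if $\Lambda=\Gamma$, i.e., $\rho(\Lambda)=\rho(\Gamma)$ and $\phi(\Lambda)=\phi(\Gamma)$. (iii) If $\phi,\varphi\in\mathcal P(\Xi)$ then $B(\phi,\varphi)=D(\phi,\varphi)$. (iv) The mapping $\Lambda\mapsto B(\Lambda,\Gamma)$ is convex for any fixed $\Gamma\in\mathcal M_+(\Xi)$. (v) For any two non-negative measures $\Lambda,\Gamma\in\mathcal M_+(\Xi)$ with $\|\Lambda\|_{TV}\le\rho$ and $\|\Gamma\|_{TV}\le\rho$, where $\rho>0$, we have $B(\Lambda,\Gamma)\ge\frac1{2\rho}\|\Lambda-\Gamma\|_{TV}^2$.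
   Context: $\mathcal M_+(\Xi)$ is the set of finite non-negative Borel measures on $\Xi$; $\|\Lambda\|_{TV}=\int_\Xi|\Lambda|(d\xi)$ is the total variation norm of a finite signed measure; $\mathcal P(\Xi)=\{\phi\in\mathcal M_+(\Xi):\int_\Xi\phi(d\xi)=1\}$ is the set of probability measures. For $\Lambda,\Gamma\in\mathcal M_+(\Xi)$, $$B(\Lambda,\Gamma)=\int_\Xi\log\Big(\frac{\Lambda(\xi)}{\Gamma(\xi)}\Big)\Lambda(d\xi)-\Big(\int_\Xi\Lambda(d\xi)-\int_\Xi\Gamma(d\xi)\Big)$$ if $\Lambda\ll\Gamma$ and $\int_\Xi\big|\log\frac{\Lambda(\xi)}{\Gamma(\xi)}\big|\Lambda(d\xi)<\infty$, and $B(\Lambda,\Gamma)=+\infty$ otherwise; here $\Lambda(\xi)/\Gamma(\xi)$ denotes the density of $\Lambda$ with respect to $\Gamma$. The Kullback-Leibler divergence of $\phi,\varphi\in\mathcal P(\Xi)$ is $D(\phi,\varphi)=\int_\Xi\log\big(\frac{\phi(\xi)}{\varphi(\xi)}\big)\phi(d\xi)$ if $\phi\ll\varphi$ and the integrand is $\phi$-integrable, and $+\infty$ otherwise. The mappings $\rho:\mathcal M_+(\Xi)\to\mathbb R$ and $\phi:\mathcal M_+(\Xi)\to\mathcal P(\Xi)$ are given by $\rho(\Lambda)=\|\Lambda\|_{TV}$ and $\phi(\Lambda)=\Lambda/\|\Lambda\|_{TV}$. The function $H:\mathbb R_+\times\mathbb R_{++}\to\mathbb R$ is $H(\rho,\rho')=\rho\log(\rho/\rho')-\rho+\rho'$,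 with $0\log0=0$. (In (iii) the symbol $\phi$ denotes a probability measure and in (v) the symbol $\rho$ denotes a positive constant, not the mappings.) *)

theory Defs
  imports "HOL-Probability.Information"
begin

definition finite_measures :: "'a::topological_space set \<Rightarrow> 'a measure set" where
  "finite_measures \<Xi> = {\<Lambda>. sets \<Lambda> = sets (restrict_space borel \<Xi>) \<and> finite_measure \<Lambda>}"

definition prob_measures :: "'a::topological_space set \<Rightarrow> 'a measure set" where
  "prob_measures \<Xi> = {\<phi> \<in> finite_measures \<Xi>. prob_space \<phi>}"

(* A finite signed measure is given by its real-valued set function nu; the measure M only
   supplies the underlying sigma-algebra.  The value is |nu|(space M), where |nu| is the total
   variation measure of nu.  The supremum is bounded whenever nu is a finite signed measure. *)
definition tv_norm :: "'a measure \<Rightarrow> ('a set \<Rightarrow> real) \<Rightarrow> real" where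
  "tv_norm M \<nu> =
     (SUP P \<in> {P. finite P \<and> P \<subseteq> sets M \<and> partition_on (space M) P}. \<Sum>A\<in>P. \<bar>\<nu> A\<bar>)"

definition tv_dist :: "'a measure \<Rightarrow> 'a measure \<Rightarrow> real" where
  "tv_dist \<Lambda> \<Gamma> = tv_norm \<Lambda> (\<lambda>A. measure \<Lambda> A - measure \<Gamma> A)"

definition total_mass :: "'a measure \<Rightarrow> real" where
  "total_mass \<Lambda> = tv_norm \<Lambda> (measure \<Lambda>)"

(* For the zero measure, where normalisation is undefined, this yields the zero measure. *)
definition normalised :: "'a measure \<Rightarrow> 'a measure" where
  "normalised \<Lambda> = scale_measure (ennreal (1 / total_mass \<Lambda>)) \<Lambda>"

(* absolutely_continuous, entropy_density and KL_divergence take the reference measure first: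
   entropy_density (exp 1) M N is the natural logarithm of the density of N with respect to M,
   and KL_divergence (exp 1) M N is its N-integral. *)
definition gen_KL :: "'a measure \<Rightarrow> 'a measure \<Rightarrow> ereal" where
  "gen_KL \<Lambda> \<Gamma> =
     (if absolutely_continuous \<Gamma> \<Lambda> \<and> integrable \<Lambda> (entropy_density (exp 1) \<Gamma> \<Lambda>)
      then ereal ((\<integral>\<xi>. entropy_density (exp 1) \<Gamma> \<Lambda> \<xi> \<partial>\<Lambda>)
                  - (measure \<Lambda> (space \<Lambda>) - measure \<Gamma> (space \<Gamma>)))
      else \<infinity>)"

definition KL :: "'a measure \<Rightarrow> 'a measure \<Rightarrow> ereal" where
  "KL \<phi> \<psi> =
     (if absolutely_continuous \<psi> \<phi> \<and> integrable \<phi> (entropy_density (exp 1) \<psi> \<phi>)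
      then ereal (KL_divergence (exp 1) \<psi> \<phi>)
      else \<infinity>)"

(* At r = 0 the factor r makes the first term vanish, i.e. 0 log 0 = 0. *)
definition scalar_KL :: "real \<Rightarrow> real \<Rightarrow> real" where
  "scalar_KL r r' = r * ln (r / r') - r + r'"

definition add_measure :: "'a measure \<Rightarrow> 'a measure \<Rightarrow> 'a measure" where
  "add_measure M N = measure_of (space M) (sets M) (\<lambda>A. emeasure M A + emeasure N A)"

lemma space_add_measure [simp]: "space (add_measure M N) = space M"
  and sets_add_measure [simp]: "sets (add_measure M N) = sets M"
  by (simp_all add: add_measure_def)

lemma emeasure_add_measure:
  assumes "sets N = sets M" and "A \<in> sets M"
  shows "emeasure (add_measure M N) A = emeasure M A + emeasure N A"
proof (rule emeasure_measure_of[OF add_measure_def])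
  show "sets M \<subseteq> Pow (space M)"
    by (rule sets.space_closed)
  show "A \<in> sets (add_measure M N)"
    using assms by simp
  show "positive (sets (add_measure M N)) (\<lambda>A. emeasure M A + emeasure N A)"
    by (simp add: positive_def)
  show "countably_additive (sets (add_measure M N)) (\<lambda>A. emeasure M A + emeasure N A)"
    unfolding countably_additive_def
    using assms(1) by (auto simp: suminf_add[symmetric] suminf_emeasure)
qed

(* t * Lam1 + (1 - t) * Lam2, for t in [0,1] *)
definition mixture :: "real \<Rightarrow> 'a measure \<Rightarrow> 'a measure \<Rightarrow> 'a measure" where
  "mixture t \<Lambda>\<^sub>1 \<Lambda>\<^sub>2 =
     add_measure (scale_measure (ennreal t) \<Lambda>\<^sub>1) (scale_measure (ennreal (1 - t)) \<Lambda>\<^sub>2)"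

end

theory Submission
  imports Defs
begin

text \<open>
  Everything rests on one formula. If \<open>\<Lambda>\<close> has density \<open>f\<close> with respect to \<open>\<Gamma>\<close>, then the
  divergence of \<open>\<Lambda>\<close> from \<open>\<Gamma>\<close> is \<open>\<integral> h (f x) d\<Gamma>\<close>, where \<open>h (r) = r ln r - r + 1\<close> is the scalar
  divergence \<open>scalar_KL r 1\<close> (lemma \<open>gen_KL_density\<close>). The mass correction is exactly what makes
  \<open>h\<close> nonnegative, so the integral can be taken with values in \<open>[0, \<infinity>]\<close>, and it is infinite
  precisely when the logarithm of the density fails to be \<open>\<Lambda>\<close>-integrable. Without a density the
  divergence is \<open>\<infinity>\<close> by definition and the inequalities are immediate.

  Properties of the divergence are therefore properties of \<open>h\<close>. That \<open>h\<close> is nonnegative with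
  its only zero at 1 gives definiteness; that \<open>h\<close> is convex gives convexity in \<open>\<Lambda>\<close>. The
  lower bound by the total variation distance is the classical proof of the Pinsker inequality:
  pointwise \<open>(r - 1)\<^sup>2 \<le> (2 r + 4) / 3 * h (r)\<close>, so by Cauchy-Schwarz
  \<open>(\<integral> \<bar>f - 1\<bar> d\<Gamma>)\<^sup>2\<close> is at most \<open>\<integral> (2 f + 4) / 3 d\<Gamma>\<close> times the divergence, and the first
  factor only depends on the two masses.

  The decomposition into a divergence of probability measures and a scalar divergence of masses
  (lemma \<open>gen_KL_decomposition\<close>) is the functional equation of the logarithm: normalising both
  measures multiplies the density by a constant. Here the integrand is not nonnegative any more, so
  integrability is tracked explicitly, and zero measures, which cannot be normalised, are treated
  separately.

  The lemmas concern finite measures on a measurable space, with \<open>M\<close> as the reference measure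
  and \<open>N\<close> as the measure that is compared with it.
\<close>

section \<open>The scalar divergence\<close>

lemma scalar_KL_0 [simp]: "scalar_KL 0 s = s"
  by (simp add: scalar_KL_def)

text \<open>This is \<open>r\<close> times the inequality \<open>ln (s / r) \<le> s / r - 1\<close>; the equality case
  below comes from the equality case \<open>s / r = 1\<close> of that inequality.\<close>

lemma scalar_KL_ge_0:
  assumes "0 \<le> r" "0 < s"
  shows "0 \<le> scalar_KL r s"
proof (cases "r = 0")
  case False
  with assms have r: "0 < r" by simp
  have "ln (s / r) \<le> s / r - 1"
    using r assms by (intro ln_le_minus_one) simp
  then have "r * ln (s / r) \<le> r * (s / r - 1)"
    using r by (intro mult_left_mono) auto
  then show ?thesis
    using r assms by (simp add: scalar_KL_def ln_div algebra_simps)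
qed (use assms in simp)

lemma scalar_KL_eq_0_iff:
  assumes "0 \<le> r" "0 < s"
  shows "scalar_KL r s = 0 \<longleftrightarrow> r = s"
proof
  assume eq: "scalar_KL r s = 0"
  then have r: "0 < r"
    using assms by (cases "r = 0") auto
  have "r * ln (s / r) = r * (s / r - 1)"
    using eq r assms by (simp add: scalar_KL_def ln_div algebra_simps)
  then have "ln (s / r) = s / r - 1"
    using r by simp
  then have "s / r = 1"
    using r assms by (intro ln_eq_minus_one) auto
  then show "r = s"
    using r by (simp add: field_simps)
qed (use assms in \<open>simp add: scalar_KL_def\<close>)

text \<open>Split the divergence from \<open>s\<close> at the convex combination \<open>z\<close> of \<open>x\<close> and \<open>y\<close>: the
  remainder after \<open>scalar_KL u z + scalar_KL z s\<close> is linear in \<open>u - z\<close>, so it averages to zero,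
  and what the averaged divergence has in excess of \<open>scalar_KL z s\<close> is an average of two
  divergences from \<open>z\<close>, which are nonnegative. This splitting needs
  \<open>z > 0\<close>; for \<open>z = 0\<close> both products \<open>t x\<close> and \<open>(1 - t) y\<close> vanish.\<close>

lemma scalar_KL_convex:
  assumes "0 \<le> x" "0 \<le> y" "0 \<le> t" "t \<le> 1" "0 < s"
  shows "scalar_KL (t * x + (1 - t) * y) s \<le> t * scalar_KL x s + (1 - t) * scalar_KL y s"
proof -
  define z where "z = t * x + (1 - t) * y"
  have z: "0 \<le> z"
    using assms by (simp add: z_def)
  show ?thesis
  proof (cases "z = 0")
    case True
    then have "t * x = 0" "(1 - t) * y = 0"
      using assms by (auto simp: z_def add_nonneg_eq_0_iff)
    then show ?thesis
      using assms by (auto simp: algebra_simps)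
  next
    case False
    with z have z: "0 < z" by simp
    \<comment> \<open>the three-point identity of Bregman divergences\<close>
    have Bregman: "scalar_KL u s = scalar_KL u z + scalar_KL z s + ln (z / s) * (u - z)" if "0 \<le> u" for u
    proof (cases "u = 0")
      case False
      with that have "0 < u" by simp
      then show ?thesis
        using z assms by (simp add: scalar_KL_def ln_div algebra_simps)
    qed (simp add: scalar_KL_def algebra_simps)
    have "t * scalar_KL x s + (1 - t) * scalar_KL y s
        = t * scalar_KL x z + (1 - t) * scalar_KL y z + scalar_KL z s
          + ln (z / s) * (t * x + (1 - t) * y - z)"
      unfolding Bregman[OF \<open>0 \<le> x\<close>] Bregman[OF \<open>0 \<le> y\<close>] by (simp add: algebra_simps)
    also have "\<dots> = t * scalar_KL x z + (1 - t) * scalar_KL y z + scalar_KL z s"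
      by (simp add: z_def)
    finally show ?thesis
      using assms z scalar_KL_ge_0[of x z] scalar_KL_ge_0[of y z] by (simp add: z_def[symmetric])
  qed
qed

text \<open>The function \<open>2 (x - 1) / (x + 1)\<close> is the first Pade approximant of \<open>ln\<close> at 1. Multiplied
  out, the difference \<open>(x + 1) ln x - 2 (x - 1)\<close> has derivative \<open>ln x + 1 / x - 1 \<ge> 0\<close> and
  vanishes at 1, so its sign is the sign of \<open>x - 1\<close>.\<close>

lemma ln_Pade_sign:
  fixes x :: real
  assumes "0 < x"
  shows "1 \<le> x \<Longrightarrow> 2 * (x - 1) \<le> (x + 1) * ln x"
    and "x \<le> 1 \<Longrightarrow> (x + 1) * ln x \<le> 2 * (x - 1)"
proof -
  let ?k = "\<lambda>x::real. (x + 1) * ln x - 2 * (x - 1)"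
  have mono: "?k a \<le> ?k b" if "0 < a" "a \<le> b" for a b
  proof (rule DERIV_nonneg_imp_nondecreasing[OF \<open>a \<le> b\<close>])
    fix y assume "a \<le> y" "y \<le> b"
    then have y: "0 < y" using that by simp
    have "(?k has_real_derivative (ln y + 1 / y - 1)) (at y)"
      using y by (auto intro!: derivative_eq_intros simp: field_simps)
    moreover have "0 \<le> ln y + 1 / y - 1"
      using ln_le_minus_one[of "1 / y"] y by (simp add: ln_div)
    ultimately show "\<exists>d. (?k has_real_derivative d) (at y) \<and> 0 \<le> d"
      by blast
  qed
  show "1 \<le> x \<Longrightarrow> 2 * (x - 1) \<le> (x + 1) * ln x"
    using mono[of 1 x] by simp
  show "x \<le> 1 \<Longrightarrow> (x + 1) * ln x \<le> 2 * (x - 1)"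
    using mono[of x 1] assms by simp
qed

text \<open>The difference \<open>g\<close> of the two sides, times 3, vanishes at 1, and its derivative is 4 times
  the function of the preceding lemma; hence \<open>g\<close> decreases on \<open>(0, 1]\<close> and increases afterwards. The
  factor \<open>(2 x + 4) / 3\<close> is the right weight because it is affine: integrated against
  \<open>\<Gamma>\<close> with \<open>x\<close> the density of \<open>\<Lambda>\<close> it gives two thirds of the mass of \<open>\<Lambda>\<close> plus four
  thirds of the mass of \<open>\<Gamma>\<close>, so at most \<open>2 \<rho>\<close> if both masses are at most \<open>\<rho>\<close>.\<close>

lemma scalar_KL_Pinsker:
  assumes "0 \<le> x"
  shows "(x - 1)\<^sup>2 \<le> (2 * x + 4) / 3 * scalar_KL x 1"
proof -
  let ?g = "\<lambda>x::real. (2 * x + 4) * (x * ln x - x + 1) - 3 * (x - 1)\<^sup>2"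
  have deriv: "(?g has_real_derivative 4 * ((y + 1) * ln y - 2 * (y - 1))) (at y)" if "0 < y" for y
    using that by (auto intro!: derivative_eq_intros simp: field_simps)
  have "0 \<le> ?g x"
  proof -
    consider "x = 0" | "1 \<le> x" | "0 < x" "x \<le> 1"
      using assms by linarith
    then show ?thesis
    proof cases
      case 2
      have "?g 1 \<le> ?g x"
      proof (rule DERIV_nonneg_imp_nondecreasing[OF 2])
        fix y :: real assume "1 \<le> y"
        then show "\<exists>d. (?g has_real_derivative d) (at y) \<and> 0 \<le> d"
          using deriv[of y] ln_Pade_sign(1)[of y]
          by (intro exI[of _ "4 * ((y + 1) * ln y - 2 * (y - 1))"]) simp
      qed
      then show ?thesis by simp
    next
      case 3
      have "?g 1 \<le> ?g x"
      proof (rule DERIV_nonpos_imp_nonincreasing[OF 3(2)])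
        fix y :: real assume "x \<le> y" "y \<le> 1"
        then show "\<exists>d. (?g has_real_derivative d) (at y) \<and> d \<le> 0"
          using deriv[of y] ln_Pade_sign(2)[of y] 3
          by (intro exI[of _ "4 * ((y + 1) * ln y - 2 * (y - 1))"]) simp
      qed
      then show ?thesis by simp
    qed simp
  qed
  then show ?thesis
    by (simp add: scalar_KL_def)
qed

section \<open>Scaling, mixtures and densities\<close>

lemma measurable_scalar_KL [measurable]:
  assumes [measurable]: "f \<in> borel_measurable M"
  shows "(\<lambda>x. scalar_KL (f x) s) \<in> borel_measurable M"
  unfolding scalar_KL_def by measurable

lemma scale_measure_eq_density: "scale_measure r M = density M (\<lambda>_. r)"
  by (rule measure_eqI) (simp_all add: emeasure_density nn_integral_cmult_indicator)

lemma null_sets_scale_measure: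
  assumes "0 < r"
  shows "null_sets (scale_measure (ennreal r) M) = null_sets M"
  using assms by (auto simp: null_sets_def)

lemma mixture_density:
  fixes f g :: "'a \<Rightarrow> real"
  assumes [measurable]: "f \<in> borel_measurable M" "g \<in> borel_measurable M"
    and "\<And>x. 0 \<le> f x" "\<And>x. 0 \<le> g x" "0 \<le> t" "t \<le> 1"
  shows "mixture t (density M f) (density M g) = density M (\<lambda>x. t * f x + (1 - t) * g x)"
proof (rule measure_eqI)
  fix A assume "A \<in> sets (mixture t (density M f) (density M g))"
  then have [measurable]: "A \<in> sets M"
    by (simp add: mixture_def)
  have "(\<integral>\<^sup>+x. ennreal (t * f x + (1 - t) * g x) * indicator A x \<partial>M)
      = (\<integral>\<^sup>+x. ennreal t * (ennreal (f x) * indicator A x)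
          + ennreal (1 - t) * (ennreal (g x) * indicator A x) \<partial>M)"
    using assms by (intro nn_integral_cong) (auto simp: ennreal_plus ennreal_mult split: split_indicator)
  also have "\<dots> = ennreal t * (\<integral>\<^sup>+x. ennreal (f x) * indicator A x \<partial>M)
      + ennreal (1 - t) * (\<integral>\<^sup>+x. ennreal (g x) * indicator A x \<partial>M)"
    by (simp add: nn_integral_add nn_integral_cmult)
  finally show "emeasure (mixture t (density M f) (density M g)) A
      = emeasure (density M (\<lambda>x. t * f x + (1 - t) * g x)) A"
    by (simp add: mixture_def emeasure_add_measure emeasure_density)
qed (simp add: mixture_def)

lemma absolutely_continuous_obtain_density:
  assumes "finite_measure M" "finite_measure N" "absolutely_continuous M N" "sets N = sets M"
  obtains f :: "'a \<Rightarrow> real" where "f \<in> borel_measurable M" "\<And>x. 0 \<le> f x" "N = density M f"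
proof -
  interpret M: finite_measure M by fact
  obtain D where [measurable]: "D \<in> borel_measurable M"
    and RN: "AE x in M. RN_deriv M N x = ennreal (D x)" and "\<And>x. 0 \<le> D x"
    using M.real_RN_deriv[OF assms(2-4)] by metis
  have "N = density M (RN_deriv M N)"
    by (rule M.density_RN_deriv[OF assms(3,4), symmetric])
  also have "\<dots> = density M D"
    using RN by (intro density_cong) auto
  finally show ?thesis
    using that[of D] \<open>\<And>x. 0 \<le> D x\<close> by simp
qed

text \<open>Radon-Nikodym derivatives are unique almost everywhere, so the one chosen inside
  \<^const>\<open>entropy_density\<close> may be replaced by any given density.\<close>

lemma entropy_density_AE:
  fixes f :: "'a \<Rightarrow> real"
  assumes "finite_measure M" and [measurable]: "f \<in> borel_measurable M" and "\<And>x. 0 \<le> f x"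
  shows "AE x in M. entropy_density (exp 1) M (density M f) x = ln (f x)"
proof -
  interpret M: finite_measure M by fact
  have "AE x in M. ennreal (f x) = RN_deriv M (density M f) x"
    by (rule M.RN_deriv_unique) auto
  then show ?thesis
  proof eventually_elim
    case (elim x)
    then show ?case
      using assms(3)[of x] by (simp add: entropy_density_def elim[symmetric] log_def)
  qed
qed

lemma integrable_density_fun:
  fixes f :: "'a \<Rightarrow> real"
  assumes "finite_measure (density M f)" and [measurable]: "f \<in> borel_measurable M"
    and "\<And>x. 0 \<le> f x"
  shows "integrable M f" "integral\<^sup>L M f = measure (density M f) (space M)"
proof -
  interpret finite_measure "density M f" by fact
  have em: "emeasure (density M f) (space M) = (\<integral>\<^sup>+x. ennreal (f x) \<partial>M)"
    by (simp add: emeasure_density cong: nn_integral_cong)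
  then have "(\<integral>\<^sup>+x. ennreal (f x) \<partial>M) < \<infinity>"
    using emeasure_finite[of "space M"] by (simp add: less_top)
  then show "integrable M f"
    using assms(3) by (intro integrableI_nonneg) auto
  show "integral\<^sup>L M f = measure (density M f) (space M)"
    using assms(3) by (simp add: measure_def em integral_eq_nn_integral)
qed

section \<open>The divergence as the integral of a nonnegative function\<close>

text \<open>Since \<open>\<integral> f\<close> and \<open>\<integral> 1\<close> are the two masses, the mass correction in \<^const>\<open>gen_KL\<close> can be
  moved under the integral, where it turns \<open>f ln f\<close> into \<open>f ln f - f + 1\<close>. This integrand is
  nonnegative and differs from \<open>f ln f\<close> by an integrable function, so failure of integrability
  means an infinite nonnegative integral: the clause of \<^const>\<open>gen_KL\<close> with value \<open>\<infinity>\<close> is covered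
  by the same formula.\<close>

lemma gen_KL_density:
  fixes f :: "'a \<Rightarrow> real"
  assumes fin: "finite_measure M" "finite_measure (density M f)"
    and [measurable]: "f \<in> borel_measurable M" and nn: "\<And>x. 0 \<le> f x"
  shows "gen_KL (density M f) M = enn2ereal (\<integral>\<^sup>+x. ennreal (scalar_KL (f x) 1) \<partial>M)"
proof -
  interpret M: finite_measure M by fact
  let ?e = "entropy_density (exp 1) M (density M f)"
  let ?h = "\<lambda>x. scalar_KL (f x) 1"
  note f = integrable_density_fun[OF fin(2) assms(3) nn]
  have h: "?h x = f x * ln (f x) - f x + 1" for x
    by (simp add: scalar_KL_def)
  have h_nn: "0 \<le> ?h x" for x
    using nn by (simp add: scalar_KL_ge_0)
  have ac: "absolutely_continuous M (density M f)"
    by (rule absolutely_continuousI_density) simp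
  have e: "AE x in M. f x *\<^sub>R ?e x = f x * ln (f x)"
    using entropy_density_AE[OF fin(1) assms(3) nn] by eventually_elim simp
  have "integrable (density M f) ?e \<longleftrightarrow> integrable M (\<lambda>x. f x *\<^sub>R ?e x)"
    using nn by (intro integrable_density) auto
  also have "\<dots> \<longleftrightarrow> integrable M (\<lambda>x. f x * ln (f x))"
    using e by (intro integrable_cong_AE) auto
  also have "\<dots> \<longleftrightarrow> integrable M ?h"
  proof
    assume "integrable M ?h"
    then have "integrable M (\<lambda>x. ?h x + (f x - 1))"
      using f by (intro Bochner_Integration.integrable_add Bochner_Integration.integrable_diff) auto
    then show "integrable M (\<lambda>x. f x * ln (f x))"
      by (simp add: h)
  qed (use f in \<open>simp add: h\<close>)
  finally have int_iff: "integrable (density M f) ?e \<longleftrightarrow> integrable M ?h" .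
  show ?thesis
  proof (cases "integrable M ?h")
    case True
    then have "integrable M (\<lambda>x. ?h x + (f x - 1))"
      using f by (intro Bochner_Integration.integrable_add Bochner_Integration.integrable_diff) auto
    then have int: "integrable M (\<lambda>x. f x * ln (f x))"
      by (simp add: h)
    have "integral\<^sup>L (density M f) ?e = (\<integral>x. f x *\<^sub>R ?e x \<partial>M)"
      using nn by (intro integral_density) auto
    also have "\<dots> = (\<integral>x. f x * ln (f x) \<partial>M)"
      using e by (intro integral_cong_AE) auto
    finally have "integral\<^sup>L (density M f) ?e
        - (measure (density M f) (space M) - measure M (space M)) = integral\<^sup>L M ?h"
      using int f by (simp add: h)
    moreover have "(\<integral>\<^sup>+x. ennreal (?h x) \<partial>M) = ennreal (integral\<^sup>L M ?h)"
      using h_nn True by (intro nn_integral_eq_integral) auto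
    ultimately show ?thesis
      using ac True h_nn by (simp add: gen_KL_def int_iff enn2ereal_ennreal Bochner_Integration.integral_nonneg)
  next
    case False
    have "(\<integral>\<^sup>+x. ennreal (?h x) \<partial>M) = \<infinity>"
    proof (rule ccontr)
      assume "(\<integral>\<^sup>+x. ennreal (?h x) \<partial>M) \<noteq> \<infinity>"
      then have "integrable M ?h"
        using h_nn by (intro integrableI_nonneg) (auto simp: less_top)
      with False show False by simp
    qed
    with False show ?thesis
      by (simp add: gen_KL_def int_iff)
  qed
qed

lemma gen_KL_cases:
  assumes "finite_measure M" "finite_measure N" "sets N = sets M"
  obtains (singular) "gen_KL N M = \<infinity>" "\<not> absolutely_continuous M N"
  | (density) f :: "'a \<Rightarrow> real" where "f \<in> borel_measurable M" "\<And>x. 0 \<le> f x" "N = density M f"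
      "gen_KL N M = enn2ereal (\<integral>\<^sup>+x. ennreal (scalar_KL (f x) 1) \<partial>M)"
proof (cases "absolutely_continuous M N")
  case True
  obtain f :: "'a \<Rightarrow> real" where "f \<in> borel_measurable M" "\<And>x. 0 \<le> f x" "N = density M f"
    using absolutely_continuous_obtain_density[OF assms(1,2) True assms(3)] by metis
  then show ?thesis
    using gen_KL_density[of M f] assms(1,2) by (intro density) auto
next
  case False
  then show ?thesis
    by (intro singular) (simp_all add: gen_KL_def)
qed

section \<open>Definiteness and convexity\<close>

lemma gen_KL_nonneg:
  assumes "finite_measure M" "finite_measure N" "sets N = sets M"
  shows "0 \<le> gen_KL N M"
  using assms by (cases rule: gen_KL_cases) auto

text \<open>A vanishing integral of a nonnegative function forces the integrand to vanish almost
  everywhere, and \<open>scalar_KL (f x) 1 = 0\<close> only for \<open>f x = 1\<close>.\<close>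

lemma gen_KL_eq_0_iff:
  assumes "finite_measure M" "finite_measure N" "sets N = sets M"
  shows "gen_KL N M = 0 \<longleftrightarrow> N = M"
proof
  assume 0: "gen_KL N M = 0"
  show "N = M"
    using assms
  proof (cases rule: gen_KL_cases)
    case (density f)
    note [measurable] = density(1)
    have "(\<integral>\<^sup>+x. ennreal (scalar_KL (f x) 1) \<partial>M) = 0"
      using 0 density(4) by (metis enn2ereal_inject zero_ennreal.rep_eq)
    then have "AE x in M. ennreal (scalar_KL (f x) 1) = 0"
      by (subst (asm) nn_integral_0_iff_AE) auto
    then have "AE x in M. ennreal (f x) = 1"
    proof eventually_elim
      case (elim x)
      then have "scalar_KL (f x) 1 = 0"
        using scalar_KL_ge_0[of "f x" 1] density(2)[of x] by (simp add: ennreal_eq_0_iff)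
      then show ?case
        using scalar_KL_eq_0_iff[of "f x" 1] density(2)[of x] by simp
    qed
    then have "density M f = density M (\<lambda>_. 1)"
      by (intro density_cong) auto
    then show ?thesis
      by (simp add: density(3) density_1)
  qed (use 0 in simp)
next
  assume "N = M"
  have M: "M = density M (\<lambda>_. ennreal 1)"
    by (simp add: density_1)
  have "gen_KL (density M (\<lambda>_. ennreal 1)) M = enn2ereal (\<integral>\<^sup>+x. ennreal (scalar_KL 1 1) \<partial>M)"
    using assms(1) by (intro gen_KL_density) (simp_all add: density_1)
  then show "gen_KL N M = 0"
    using \<open>N = M\<close> by (simp add: density_1 scalar_KL_def zero_ennreal.rep_eq)
qed

text \<open>With densities \<open>f\<close> and \<open>g\<close> of the two measures, the mixture has the density
  \<open>t f + (1 - t) g\<close>, and the pointwise convexity of \<^const>\<open>scalar_KL\<close> integrates. If one of the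
  measures has no density and \<open>0 < t < 1\<close>, then the right-hand side is \<open>\<infinity>\<close>; for \<open>t = 0\<close> and
  \<open>t = 1\<close> that argument fails because \<open>0 * \<infinity> = 0\<close>, but there the mixture is one of the
  measures itself.\<close>

lemma gen_KL_convex:
  assumes fin: "finite_measure M" "finite_measure N\<^sub>1" "finite_measure N\<^sub>2"
    and sets: "sets N\<^sub>1 = sets M" "sets N\<^sub>2 = sets M" and t: "0 \<le> t" "t \<le> 1"
  shows "gen_KL (mixture t N\<^sub>1 N\<^sub>2) M \<le> ereal t * gen_KL N\<^sub>1 M + ereal (1 - t) * gen_KL N\<^sub>2 M"
proof -
  have mix0: "mixture 0 N\<^sub>1 N\<^sub>2 = N\<^sub>2"
    using sets by (intro measure_eqI) (simp_all add: mixture_def emeasure_add_measure)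
  have mix1: "mixture 1 N\<^sub>1 N\<^sub>2 = N\<^sub>1"
    using sets by (intro measure_eqI) (simp_all add: mixture_def emeasure_add_measure)
  consider "t = 0" | "t = 1" | "0 < t" "t < 1"
    using t by linarith
  then show ?thesis
  proof cases
    case 3
    note nonneg = gen_KL_nonneg[OF fin(1,2) sets(1)] gen_KL_nonneg[OF fin(1,3) sets(2)]
    show ?thesis
      using fin(1,2) sets(1)
    proof (cases rule: gen_KL_cases)
      case singular
      then show ?thesis
        using 3 nonneg by simp
    next
      case (density f)
      note f = this
      show ?thesis
        using fin(1,3) sets(2)
      proof (cases rule: gen_KL_cases)
        case singular
        then show ?thesis
          using 3 nonneg by simp
      next
        case (density g)
        note g = this
        note [measurable] = f(1) g(1)
        let ?m = "\<lambda>x. t * f x + (1 - t) * g x"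
        have mix: "mixture t N\<^sub>1 N\<^sub>2 = density M ?m"
          unfolding f(3) g(3) using f g t by (intro mixture_density) auto
        have int: "integrable M f" "integrable M g"
          using integrable_density_fun[of M f] integrable_density_fun[of M g] f g fin by auto
        have "finite_measure (density M ?m)"
        proof (rule finite_measureI)
          have "(\<integral>\<^sup>+x. ennreal (?m x) \<partial>M) = ennreal (integral\<^sup>L M ?m)"
            using int f(2) g(2) t by (intro nn_integral_eq_integral) auto
          then show "emeasure (density M ?m) (space (density M ?m)) \<noteq> \<infinity>"
            by (simp add: emeasure_density cong: nn_integral_cong)
        qed
        then have "gen_KL (mixture t N\<^sub>1 N\<^sub>2) M = enn2ereal (\<integral>\<^sup>+x. ennreal (scalar_KL (?m x) 1) \<partial>M)"
          unfolding mix using fin(1) f(2) g(2) t by (intro gen_KL_density) auto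
        also have "\<dots> \<le> enn2ereal (\<integral>\<^sup>+x. ennreal t * ennreal (scalar_KL (f x) 1)
            + ennreal (1 - t) * ennreal (scalar_KL (g x) 1) \<partial>M)"
          unfolding less_eq_ennreal.rep_eq[symmetric]
        proof (rule nn_integral_mono)
          fix x
          have "scalar_KL (?m x) 1 \<le> t * scalar_KL (f x) 1 + (1 - t) * scalar_KL (g x) 1"
            using f(2) g(2) t by (intro scalar_KL_convex) auto
          then show "ennreal (scalar_KL (?m x) 1)
              \<le> ennreal t * ennreal (scalar_KL (f x) 1) + ennreal (1 - t) * ennreal (scalar_KL (g x) 1)"
            using f(2) g(2) t
            by (simp add: ennreal_mult[symmetric] scalar_KL_ge_0 ennreal_leI flip: ennreal_plus)
        qed
        also have "\<dots> = enn2ereal (ennreal t * (\<integral>\<^sup>+x. ennreal (scalar_KL (f x) 1) \<partial>M)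
            + ennreal (1 - t) * (\<integral>\<^sup>+x. ennreal (scalar_KL (g x) 1) \<partial>M))"
          by (simp add: nn_integral_add nn_integral_cmult)
        also have "\<dots> = ereal t * gen_KL N\<^sub>1 M + ereal (1 - t) * gen_KL N\<^sub>2 M"
          using t by (simp add: f(4) g(4) plus_ennreal.rep_eq times_ennreal.rep_eq enn2ereal_ennreal)
        finally show ?thesis .
      qed
    qed
  qed (simp_all add: mix0 mix1 flip: zero_ereal_def one_ereal_def)
qed

section \<open>Total variation and the Pinsker inequality\<close>

text \<open>The trivial partition \<open>{space M}\<close> is not one for an empty space, since the blocks of a
  partition are nonempty; the empty partition takes its place.\<close>

lemma ex_finite_measurable_partition:
  "{P. finite P \<and> P \<subseteq> sets M \<and> partition_on (space M) P} \<noteq> {}"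
proof (cases "space M = {}")
  case True
  then show ?thesis
    by (auto simp: partition_on_empty)
next
  case False
  then have "{space M} \<in> {P. finite P \<and> P \<subseteq> sets M \<and> partition_on (space M) P}"
    by (simp add: partition_on_space)
  then show ?thesis
    by (metis empty_iff)
qed

lemma total_mass_eq_measure:
  assumes "finite_measure M"
  shows "total_mass M = measure M (space M)"
proof -
  interpret finite_measure M by fact
  let ?P = "{P. finite P \<and> P \<subseteq> sets M \<and> partition_on (space M) P}"
  have "(\<Sum>A\<in>P. \<bar>measure M A\<bar>) = measure M (space M)" if "P \<in> ?P" for P
  proof -
    have "measure M (\<Union>A\<in>P. A) = (\<Sum>A\<in>P. measure M A)"
      using that by (intro finite_measure_finite_Union)
        (auto simp: partition_on_def disjoint_def disjoint_family_on_def)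
    then show ?thesis
      using that partition_onD1[of "space M" P] by simp
  qed
  then have "total_mass M = (SUP P\<in>?P. measure M (space M))"
    unfolding total_mass_def tv_norm_def by (intro SUP_cong) auto
  also have "\<dots> = measure M (space M)"
    using ex_finite_measurable_partition by (rule cSUP_const)
  finally show ?thesis .
qed

text \<open>On each block \<open>A\<close> the difference of the measures is \<open>\<integral>\<^sub>A (f - 1)\<close>. Nonnegativity is not
  automatic: a real supremum is only above its members if they are bounded, which is what the upper
  bound provides. It is needed when the distance is squared.\<close>

lemma tv_dist_density:
  fixes f :: "'a \<Rightarrow> real"
  assumes "finite_measure M" "finite_measure (density M f)"
    and [measurable]: "f \<in> borel_measurable M" and nn: "\<And>x. 0 \<le> f x"
  shows "0 \<le> tv_dist (density M f) M"
    and "tv_dist (density M f) M \<le> (\<integral>x. \<bar>f x - 1\<bar> \<partial>M)"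
proof -
  interpret finite_measure M by fact
  have f: "integrable M f"
    using assms by (intro integrable_density_fun)
  then have abs: "integrable M (\<lambda>x. \<bar>f x - 1\<bar>)"
    by simp
  have A: "\<bar>measure (density M f) A - measure M A\<bar> \<le> (\<integral>x\<in>A. \<bar>f x - 1\<bar> \<partial>M)" if [measurable]: "A \<in> sets M" for A
  proof -
    have iA: "integrable M (\<lambda>x. indicator A x * f x)" "integrable M (\<lambda>x. indicator A x :: real)"
      using f by (auto intro!: integrable_real_mult_indicator simp: mult.commute less_top[symmetric])
    have "measure (density M f) A = enn2real (\<integral>\<^sup>+x. ennreal (indicator A x * f x) \<partial>M)"
      by (auto simp: measure_def emeasure_density intro!: arg_cong[where f=enn2real] nn_integral_cong
          split: split_indicator)
    also have "\<dots> = (\<integral>x. indicator A x * f x \<partial>M)"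
      using nn by (intro integral_eq_nn_integral[symmetric]) auto
    finally have "measure (density M f) A - measure M A = (\<integral>x. indicator A x * f x - indicator A x \<partial>M)"
      using iA by (simp)
    also have "\<bar>\<dots>\<bar> \<le> (\<integral>x. \<bar>indicator A x * f x - indicator A x\<bar> \<partial>M)"
      by (rule integral_abs_bound)
    also have "\<dots> = (\<integral>x\<in>A. \<bar>f x - 1\<bar> \<partial>M)"
      unfolding set_lebesgue_integral_def
      by (intro Bochner_Integration.integral_cong) (auto split: split_indicator)
    finally show ?thesis .
  qed
  let ?P = "{P. finite P \<and> P \<subseteq> sets M \<and> partition_on (space M) P}"
  have nonempty: "?P \<noteq> {}"
    by (rule ex_finite_measurable_partition)
  have le: "(\<Sum>A\<in>P. \<bar>measure (density M f) A - measure M A\<bar>) \<le> (\<integral>x. \<bar>f x - 1\<bar> \<partial>M)"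
    if P: "P \<in> ?P" for P
  proof -
    have "(\<Sum>A\<in>P. \<bar>measure (density M f) A - measure M A\<bar>) \<le> (\<Sum>A\<in>P. \<integral>x\<in>A. \<bar>f x - 1\<bar> \<partial>M)"
      using P A by (intro sum_mono) auto
    also have "\<dots> = (\<integral>x\<in>(\<Union>A\<in>P. A). \<bar>f x - 1\<bar> \<partial>M)"
    proof (rule set_integral_finite_Union[symmetric])
      show "disjoint_family_on (\<lambda>A. A) P"
        using P by (auto simp: partition_on_def disjoint_def disjoint_family_on_def)
      show "set_integrable M A (\<lambda>x. \<bar>f x - 1\<bar>)" if "A \<in> P" for A
        unfolding set_integrable_def using P that abs by (intro integrable_mult_indicator) auto
    qed (use P in auto)
    also have "(\<Union>A\<in>P. A) = space M"
      using P partition_onD1[of "space M" P] by simp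
    also have "(\<integral>x\<in>space M. \<bar>f x - 1\<bar> \<partial>M) = (\<integral>x. \<bar>f x - 1\<bar> \<partial>M)"
      using abs by (rule set_integral_space)
    finally show ?thesis .
  qed
  show "tv_dist (density M f) M \<le> (\<integral>x. \<bar>f x - 1\<bar> \<partial>M)"
    unfolding tv_dist_def tv_norm_def using nonempty le by (intro cSUP_least) auto
  obtain P where P: "P \<in> ?P"
    using nonempty by blast
  have "bdd_above ((\<lambda>P. \<Sum>A\<in>P. \<bar>measure (density M f) A - measure M A\<bar>) ` ?P)"
    using le by (intro bdd_aboveI2)
  then have "(\<Sum>A\<in>P. \<bar>measure (density M f) A - measure M A\<bar>) \<le> tv_dist (density M f) M"
    unfolding tv_dist_def tv_norm_def using P by (intro cSUP_upper) auto
  then show "0 \<le> tv_dist (density M f) M"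
    by (rule order_trans[rotated]) (simp add: sum_nonneg)
qed

text \<open>Cauchy-Schwarz applied to \<open>\<bar>f - 1\<bar> \<le> sqrt w * sqrt h\<close>, where \<open>w = (2 f + 4) / 3\<close>
  and \<open>h = scalar_KL f 1\<close>, bounds the squared distance by \<open>\<integral> w\<close> times the divergence, and
  \<open>\<integral> w\<close> is at most \<open>2 \<rho>\<close>. Working with nonnegative integrals covers an infinite divergence
  as well.\<close>

lemma gen_KL_Pinsker:
  assumes fin: "finite_measure M" "finite_measure N" and sets: "sets N = sets M"
    and \<rho>: "0 < \<rho>" "total_mass N \<le> \<rho>" "total_mass M \<le> \<rho>"
  shows "ereal (1 / (2 * \<rho>) * (tv_dist N M)\<^sup>2) \<le> gen_KL N M"
  using fin sets
proof (cases rule: gen_KL_cases)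
  case (density f)
  note [measurable] = density(1)
  interpret M: finite_measure M by fact
  let ?h = "\<lambda>x. scalar_KL (f x) 1" and ?w = "\<lambda>x. (2 * f x + 4) / 3"
  let ?I = "\<integral>\<^sup>+x. ennreal (?h x) \<partial>M"
  have nn: "0 \<le> f x" "0 \<le> ?h x" "0 \<le> ?w x" for x
    using density(2)[of x] by (simp_all add: scalar_KL_ge_0)
  have f: "integrable M f" "integral\<^sup>L M f = measure N (space N)"
    using integrable_density_fun[of M f] density fin by auto
  note tv = tv_dist_density[of M f, folded density(3), OF fin density(1,2)]
  have w: "(\<integral>\<^sup>+x. ennreal (?w x) \<partial>M) \<le> ennreal (2 * \<rho>)"
  proof -
    have "(\<integral>\<^sup>+x. ennreal (?w x) \<partial>M) = ennreal (integral\<^sup>L M ?w)"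
      using f nn(3) by (intro nn_integral_eq_integral) auto
    also have "integral\<^sup>L M ?w = (2 * measure N (space N) + 4 * measure M (space M)) / 3"
      using f by simp
    also have "ennreal \<dots> \<le> ennreal (2 * \<rho>)"
      using \<rho> fin by (intro ennreal_leI) (simp add: total_mass_eq_measure)
    finally show ?thesis .
  qed
  have "ennreal (tv_dist N M) \<le> ennreal (\<integral>x. \<bar>f x - 1\<bar> \<partial>M)"
    using tv(2) by (rule ennreal_leI)
  also have "\<dots> = (\<integral>\<^sup>+x. ennreal \<bar>f x - 1\<bar> \<partial>M)"
    using f by (intro nn_integral_eq_integral[symmetric]) auto
  also have "\<dots> \<le> (\<integral>\<^sup>+x. ennreal (sqrt (?w x)) * ennreal (sqrt (?h x)) \<partial>M)"
  proof (rule nn_integral_mono)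
    fix x
    have "\<bar>f x - 1\<bar> \<le> sqrt (?w x * ?h x)"
      using scalar_KL_Pinsker[OF nn(1)[of x]] by (intro real_le_rsqrt) simp
    also have "\<dots> = sqrt (?w x) * sqrt (?h x)"
      by (rule real_sqrt_mult)
    finally have "\<bar>f x - 1\<bar> \<le> sqrt (?w x) * sqrt (?h x)" .
    then show "ennreal \<bar>f x - 1\<bar> \<le> ennreal (sqrt (?w x)) * ennreal (sqrt (?h x))"
      using nn[of x] by (subst ennreal_mult[symmetric]) (auto intro: ennreal_leI)
  qed
  finally have "(ennreal (tv_dist N M))\<^sup>2
      \<le> (\<integral>\<^sup>+x. ennreal (sqrt (?w x)) * ennreal (sqrt (?h x)) \<partial>M)\<^sup>2"
    by (intro power_mono) auto
  also have "\<dots> \<le> (\<integral>\<^sup>+x. (ennreal (sqrt (?w x)))\<^sup>2 \<partial>M) * (\<integral>\<^sup>+x. (ennreal (sqrt (?h x)))\<^sup>2 \<partial>M)"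
    by (rule Cauchy_Schwarz_nn_integral) auto
  also have "\<dots> = (\<integral>\<^sup>+x. ennreal (?w x) \<partial>M) * ?I"
    using nn by (simp add: ennreal_power)
  also have "\<dots> \<le> ennreal (2 * \<rho>) * ?I"
    using w by (rule mult_right_mono) simp
  finally have "ennreal (1 / (2 * \<rho>)) * (ennreal (tv_dist N M))\<^sup>2
      \<le> ennreal (1 / (2 * \<rho>)) * (ennreal (2 * \<rho>) * ?I)"
    by (rule mult_left_mono) simp
  also have "\<dots> = ?I"
    using \<rho>(1) by (simp add: mult.assoc[symmetric] flip: ennreal_mult)
  also have "ennreal (1 / (2 * \<rho>)) * (ennreal (tv_dist N M))\<^sup>2
      = ennreal (1 / (2 * \<rho>) * (tv_dist N M)\<^sup>2)"
    using \<rho>(1) tv(1) by (simp add: ennreal_power flip: ennreal_mult)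
  finally have "enn2ereal (ennreal (1 / (2 * \<rho>) * (tv_dist N M)\<^sup>2)) \<le> enn2ereal ?I"
    by (simp only: less_eq_ennreal.rep_eq)
  then show ?thesis
    using \<rho>(1) by (subst (asm) enn2ereal_ennreal) (simp_all add: density(4))
qed simp

section \<open>Normalisation and the decomposition of the divergence\<close>

lemma emeasure_eq_0_if_total_mass_eq_0:
  assumes "finite_measure M" "total_mass M = 0"
  shows "emeasure M A = 0"
proof -
  interpret finite_measure M by fact
  have "emeasure M (space M) = 0"
    using assms by (simp add: total_mass_eq_measure emeasure_eq_measure)
  then show ?thesis
    by (metis emeasure_space le_zero_eq)
qed

lemma total_mass_nonneg:
  assumes "finite_measure M"
  shows "0 \<le> total_mass M"
  by (simp add: total_mass_eq_measure[OF assms])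

lemma eq_iff_total_mass_normalised_eq:
  assumes fin: "finite_measure M" "finite_measure N" and sets: "sets N = sets M"
  shows "N = M \<longleftrightarrow> total_mass N = total_mass M \<and> normalised N = normalised M"
proof (intro iffI; (elim conjE)?)
  assume mass: "total_mass N = total_mass M" and norm: "normalised N = normalised M"
  show "N = M"
  proof (cases "total_mass M = 0")
    case True
    then show ?thesis
      using mass fin sets by (intro measure_eqI) (simp_all add: emeasure_eq_0_if_total_mass_eq_0)
  next
    case False
    then have m: "0 < total_mass M"
      using total_mass_nonneg[OF fin(1)] by simp
    have rescale: "scale_measure (ennreal (total_mass M)) (scale_measure (ennreal (1 / total_mass M)) L) = L"
      for L :: "'a measure"
      using m by (simp flip: ennreal_mult)
    have "N = scale_measure (ennreal (total_mass M)) (normalised N)"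
      unfolding normalised_def mass by (rule rescale[symmetric])
    also have "\<dots> = M"
      unfolding norm unfolding normalised_def by (rule rescale)
    finally show ?thesis .
  qed
qed simp

lemma finite_measure_normalised:
  assumes "finite_measure M"
  shows "finite_measure (normalised M)"
proof (rule finite_measureI)
  interpret finite_measure M by fact
  show "emeasure (normalised M) (space (normalised M)) \<noteq> \<infinity>"
    by (simp add: normalised_def space_scale_measure ennreal_mult_eq_top_iff)
qed

text \<open>The factors \<open>1 / total_mass\<close> on the two sides are different, which leaves the
  quotient of the masses in the density.\<close>

lemma normalised_density:
  fixes f :: "'a \<Rightarrow> real"
  assumes [measurable]: "f \<in> borel_measurable M" and nn: "\<And>x. 0 \<le> f x"
    and mass: "0 < total_mass M" "0 < total_mass (density M f)"
  shows "normalised (density M f)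
    = density (normalised M) (\<lambda>x. total_mass M / total_mass (density M f) * f x)"
proof -
  let ?a = "total_mass (density M f)" and ?b = "total_mass M"
  have "normalised (density M f) = density M (\<lambda>x. ennreal (f x) * ennreal (1 / ?a))"
    by (simp add: normalised_def scale_measure_eq_density density_density_eq)
  also have "\<dots> = density M (\<lambda>x. ennreal (1 / ?b) * ennreal (?b / ?a * f x))"
    using mass nn by (intro density_cong) (auto simp flip: ennreal_mult simp: field_simps)
  also have "\<dots> = density (normalised M) (\<lambda>x. ?b / ?a * f x)"
    by (simp add: normalised_def scale_measure_eq_density density_density_eq)
  finally show ?thesis .
qed

text \<open>For positive masses \<open>a\<close> of \<open>N\<close> and \<open>b\<close> of \<open>M\<close>, the density of the normalised measures is
  \<open>b / a\<close> times the density of \<open>N\<close>, so its logarithm is shifted by the constant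
  \<open>ln (b / a)\<close>. As \<open>N\<close> is finite, the shift does not affect integrability, and its contribution
  \<open>a ln (b / a)\<close> to the integral is cancelled by the leading term of \<open>scalar_KL a b\<close>.
  Normalising preserves absolute continuity in both directions, so both sides are \<open>\<infinity>\<close> together.
  If \<open>N\<close> is zero, both sides are \<open>b\<close>, whatever \<^const>\<open>KL\<close> assigns to the normalisation of
  \<open>N\<close>, since it is multiplied by 0. If only \<open>M\<close> is zero, absolute continuity fails.\<close>

lemma gen_KL_decomposition:
  assumes fin: "finite_measure M" "finite_measure N" and sets: "sets N = sets M"
  shows "gen_KL N M = ereal (total_mass N) * KL (normalised N) (normalised M)
    + ereal (scalar_KL (total_mass N) (total_mass M))"
proof (cases "total_mass N = 0")
  case True
  have "emeasure N A = 0" for A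
    using emeasure_eq_0_if_total_mass_eq_0[OF fin(2) True] .
  then have N: "N = null_measure M"
    using sets by (intro measure_eqI) auto
  have ac: "absolutely_continuous M N"
    by (auto simp: N absolutely_continuous_def null_sets_def)
  have null: "integrable N g" "integral\<^sup>L N g = 0" if "g \<in> borel_measurable M" for g :: "'a \<Rightarrow> real"
  proof -
    have "AE x in N. g x = 0"
      by (rule AE_I'[of "space N"]) (auto simp: N null_sets_def)
    moreover have "g \<in> borel_measurable N"
      using that by (subst measurable_cong_sets[OF sets refl])
    ultimately have "integrable N g \<longleftrightarrow> integrable N (\<lambda>_. 0 :: real)"
      by (intro integrable_cong_AE) simp_all
    then show "integrable N g"
      by simp
    show "integral\<^sup>L N g = 0"
      using \<open>AE x in N. g x = 0\<close> by (rule integral_eq_zero_AE)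
  qed
  have "measure N (space N) = 0"
    using True by (simp add: total_mass_eq_measure[OF fin(2)])
  then have "gen_KL N M = ereal (total_mass M)"
    using ac null[OF measurable_entropy_density[of "exp 1" M N]]
    by (simp add: gen_KL_def total_mass_eq_measure[OF fin(1)])
  then show ?thesis
    by (simp add: True flip: zero_ereal_def)
next
  case False
  then have a: "0 < total_mass N"
    using total_mass_nonneg[OF fin(2)] by simp
  have null_N: "null_sets (normalised N) = null_sets N"
    using a by (simp add: normalised_def null_sets_scale_measure)
  show ?thesis
  proof (cases "absolutely_continuous M N")
    case False
    have "\<not> absolutely_continuous (normalised M) (normalised N)"
    proof
      assume "absolutely_continuous (normalised M) (normalised N)"
      then have "null_sets (normalised M) \<subseteq> null_sets N"
        by (simp add: absolutely_continuous_def null_N)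
      moreover have "null_sets M \<subseteq> null_sets (normalised M)"
        by (auto simp: normalised_def null_sets_def)
      ultimately show False
        using False by (auto simp: absolutely_continuous_def)
    qed
    then show ?thesis
      using a False by (simp add: gen_KL_def KL_def)
  next
    case True
    obtain f :: "'a \<Rightarrow> real" where [measurable]: "f \<in> borel_measurable M"
      and nn: "\<And>x. 0 \<le> f x" and N: "N = density M f"
      using absolutely_continuous_obtain_density[OF fin True sets] by metis
    \<comment> \<open>absolute continuity excludes a zero reference measure, because \<open>N\<close> has positive mass\<close>
    have b: "0 < total_mass M"
    proof (rule ccontr)
      assume "\<not> 0 < total_mass M"
      then have "total_mass M = 0"
        using total_mass_nonneg[OF fin(1)] by simp
      then have "space M \<in> null_sets N"
        using True emeasure_eq_0_if_total_mass_eq_0[OF fin(1)]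
        by (auto simp: absolutely_continuous_def null_sets_def)
      then show False
        using a sets_eq_imp_space_eq[OF sets] by (simp add: total_mass_eq_measure[OF fin(2)] measure_def null_sets_def)
    qed
    let ?a = "total_mass N" and ?b = "total_mass M"
    let ?e = "entropy_density (exp 1) M N"
    let ?e' = "entropy_density (exp 1) (normalised M) (normalised N)"
    have norm_N: "normalised N = density (normalised M) (\<lambda>x. ?b / ?a * f x)"
      using normalised_density[of f M] nn a b by (simp add: N)
    have sets_norm [measurable_cong]: "sets (normalised M) = sets M" "sets N = sets M"
      by (simp_all add: normalised_def sets)
    have ac': "absolutely_continuous (normalised M) (normalised N)"
      unfolding norm_N by (rule absolutely_continuousI_density) measurable
    have "AE x in M. ?e x = ln (f x)"
      unfolding N using fin(1) nn by (intro entropy_density_AE) auto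
    moreover have "AE x in normalised M. ?e' x = ln (?b / ?a * f x)"
      unfolding norm_N using fin(1) nn a b
      by (intro entropy_density_AE finite_measure_normalised) auto
    then have "AE x in M. ?e' x = ln (?b / ?a * f x)"
      using b by (simp add: eventually_ae_filter normalised_def null_sets_scale_measure space_scale_measure)
    ultimately have "AE x in M. ?e x = ln (f x) \<and> ?e' x = ln (?b / ?a * f x)"
      by (rule eventually_conj)
    \<comment> \<open>The logarithm splits only where \<open>f\<close> is positive, which is almost everywhere for \<open>N\<close>
        though not for \<open>M\<close>.\<close>
    then have "AE x in M. 0 < ennreal (f x) \<longrightarrow> ?e' x = ln (?b / ?a) + ?e x"
    proof (rule eventually_mono)
      fix x assume *: "?e x = ln (f x) \<and> ?e' x = ln (?b / ?a * f x)"
      show "0 < ennreal (f x) \<longrightarrow> ?e' x = ln (?b / ?a) + ?e x"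
      proof
        assume "0 < ennreal (f x)"
        then have "ln (?b / ?a * f x) = ln (?b / ?a) + ln (f x)"
          using a b by (intro ln_mult_pos) auto
        then show "?e' x = ln (?b / ?a) + ?e x"
          using * by simp
      qed
    qed
    then have shift: "AE x in N. ?e' x = ln (?b / ?a) + ?e x"
      unfolding N by (subst AE_density) auto
    interpret N: finite_measure N by fact
    have [measurable]: "?e \<in> borel_measurable M" "?e' \<in> borel_measurable M"
      using measurable_entropy_density[of "exp 1" "normalised M" "normalised N"] by simp_all
    have norm_dens: "normalised N = density N (\<lambda>_. ennreal (1 / ?a))"
      by (simp add: normalised_def scale_measure_eq_density)
    have "integrable (normalised N) ?e' \<longleftrightarrow> integrable N (\<lambda>x. (1 / ?a) *\<^sub>R ?e' x)"
      unfolding norm_dens using a by (intro integrable_density) auto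
    also have "\<dots> \<longleftrightarrow> integrable N ?e'"
      unfolding real_scaleR_def integrable_mult_left_iff using a by simp
    also have "\<dots> \<longleftrightarrow> integrable N (\<lambda>x. ln (?b / ?a) + ?e x)"
      using shift by (intro integrable_cong_AE) auto
    also have "\<dots> \<longleftrightarrow> integrable N ?e"
    proof
      assume "integrable N (\<lambda>x. ln (?b / ?a) + ?e x)"
      then have "integrable N (\<lambda>x. (ln (?b / ?a) + ?e x) - ln (?b / ?a))"
        by (rule Bochner_Integration.integrable_diff) simp
      then show "integrable N ?e"
        by simp
    qed simp
    finally have int_iff: "integrable (normalised N) ?e' \<longleftrightarrow> integrable N ?e" .
    show ?thesis
    proof (cases "integrable N ?e")
      case int: True
      have "integral\<^sup>L (normalised N) ?e' = (\<integral>x. (1 / ?a) *\<^sub>R ?e' x \<partial>N)"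
        unfolding norm_dens using a by (intro integral_density) auto
      also have "\<dots> = (\<integral>x. ?e' x \<partial>N) / ?a"
        by simp
      also have "(\<integral>x. ?e' x \<partial>N) = (\<integral>x. ln (?b / ?a) + ?e x \<partial>N)"
        using shift by (intro integral_cong_AE) auto
      also have "\<dots> = ?a * ln (?b / ?a) + integral\<^sup>L N ?e"
        using int by (simp add: total_mass_eq_measure[OF fin(2)])
      finally have "?a * integral\<^sup>L (normalised N) ?e' = ?a * ln (?b / ?a) + integral\<^sup>L N ?e"
        using a by simp
      then show ?thesis
        using True ac' int int_iff a b
        by (simp add: gen_KL_def KL_def KL_divergence_def scalar_KL_def ln_div
            total_mass_eq_measure[OF fin(1), symmetric] total_mass_eq_measure[OF fin(2), symmetric] algebra_simps)
    next
      case False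
      then show ?thesis
        using int_iff a by (simp add: gen_KL_def KL_def)
    qed
  qed
qed

lemma gen_KL_prob_space:
  assumes "prob_space M" "prob_space N"
  shows "gen_KL N M = KL N M"
  using assms by (simp add: gen_KL_def KL_def KL_divergence_def prob_space.prob_space)

theorem theorem3p4:
  fixes \<Xi> :: "(real ^ 'd) set"
  assumes "compact \<Xi>" and "convex \<Xi>" and "aff_dim \<Xi> = int CARD('d)"
  shows "(\<forall>\<Lambda>\<in>finite_measures \<Xi>. \<forall>\<Gamma>\<in>finite_measures \<Xi>.
            gen_KL \<Lambda> \<Gamma> = ereal (total_mass \<Lambda>) * KL (normalised \<Lambda>) (normalised \<Gamma>)
                         + ereal (scalar_KL (total_mass \<Lambda>) (total_mass \<Gamma>)))
       \<and> (\<forall>\<Lambda>\<in>finite_measures \<Xi>. \<forall>\<Gamma>\<in>finite_measures \<Xi>.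
            gen_KL \<Lambda> \<Gamma> \<ge> 0
            \<and> (gen_KL \<Lambda> \<Gamma> = 0 \<longleftrightarrow> \<Lambda> = \<Gamma>)
            \<and> (\<Lambda> = \<Gamma> \<longleftrightarrow> total_mass \<Lambda> = total_mass \<Gamma> \<and> normalised \<Lambda> = normalised \<Gamma>))
       \<and> (\<forall>\<phi>\<in>prob_measures \<Xi>. \<forall>\<psi>\<in>prob_measures \<Xi>. gen_KL \<phi> \<psi> = KL \<phi> \<psi>)
       \<and> (\<forall>\<Gamma>\<in>finite_measures \<Xi>. \<forall>\<Lambda>\<^sub>1\<in>finite_measures \<Xi>. \<forall>\<Lambda>\<^sub>2\<in>finite_measures \<Xi>. \<forall>t\<in>{0..1}.
            gen_KL (mixture t \<Lambda>\<^sub>1 \<Lambda>\<^sub>2) \<Gamma> \<le> ereal t * gen_KL \<Lambda>\<^sub>1 \<Gamma> + ereal (1 - t) * gen_KL \<Lambda>\<^sub>2 \<Gamma>)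
       \<and> (\<forall>\<rho>>0. \<forall>\<Lambda>\<in>finite_measures \<Xi>. \<forall>\<Gamma>\<in>finite_measures \<Xi>.
            total_mass \<Lambda> \<le> \<rho> \<longrightarrow> total_mass \<Gamma> \<le> \<rho> \<longrightarrow>
            gen_KL \<Lambda> \<Gamma> \<ge> ereal (1 / (2 * \<rho>) * (tv_dist \<Lambda> \<Gamma>)\<^sup>2))"
proof (intro conjI)
  have sets: "sets \<Lambda> = sets \<Gamma>" if "\<Lambda> \<in> finite_measures \<Xi>" "\<Gamma> \<in> finite_measures \<Xi>" for \<Lambda> \<Gamma>
    using that by (simp add: finite_measures_def)
  have fin: "finite_measure \<Lambda>" if "\<Lambda> \<in> finite_measures \<Xi>" for \<Lambda>
    using that by (simp add: finite_measures_def)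
  show "\<forall>\<Lambda>\<in>finite_measures \<Xi>. \<forall>\<Gamma>\<in>finite_measures \<Xi>.
      gen_KL \<Lambda> \<Gamma> = ereal (total_mass \<Lambda>) * KL (normalised \<Lambda>) (normalised \<Gamma>)
        + ereal (scalar_KL (total_mass \<Lambda>) (total_mass \<Gamma>))"
    by (intro ballI gen_KL_decomposition fin sets)
  show "\<forall>\<Lambda>\<in>finite_measures \<Xi>. \<forall>\<Gamma>\<in>finite_measures \<Xi>.
      gen_KL \<Lambda> \<Gamma> \<ge> 0 \<and> (gen_KL \<Lambda> \<Gamma> = 0 \<longleftrightarrow> \<Lambda> = \<Gamma>)
      \<and> (\<Lambda> = \<Gamma> \<longleftrightarrow> total_mass \<Lambda> = total_mass \<Gamma> \<and> normalised \<Lambda> = normalised \<Gamma>)"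
    by (intro ballI conjI gen_KL_nonneg gen_KL_eq_0_iff eq_iff_total_mass_normalised_eq fin sets)
  show "\<forall>\<phi>\<in>prob_measures \<Xi>. \<forall>\<psi>\<in>prob_measures \<Xi>. gen_KL \<phi> \<psi> = KL \<phi> \<psi>"
    by (simp add: prob_measures_def gen_KL_prob_space)
  show "\<forall>\<Gamma>\<in>finite_measures \<Xi>. \<forall>\<Lambda>\<^sub>1\<in>finite_measures \<Xi>. \<forall>\<Lambda>\<^sub>2\<in>finite_measures \<Xi>. \<forall>t\<in>{0..1}.
      gen_KL (mixture t \<Lambda>\<^sub>1 \<Lambda>\<^sub>2) \<Gamma> \<le> ereal t * gen_KL \<Lambda>\<^sub>1 \<Gamma> + ereal (1 - t) * gen_KL \<Lambda>\<^sub>2 \<Gamma>"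
    by (intro ballI gen_KL_convex fin sets) auto
  show "\<forall>\<rho>>0. \<forall>\<Lambda>\<in>finite_measures \<Xi>. \<forall>\<Gamma>\<in>finite_measures \<Xi>.
      total_mass \<Lambda> \<le> \<rho> \<longrightarrow> total_mass \<Gamma> \<le> \<rho> \<longrightarrow>
      gen_KL \<Lambda> \<Gamma> \<ge> ereal (1 / (2 * \<rho>) * (tv_dist \<Lambda> \<Gamma>)\<^sup>2)"
    by (intro allI ballI impI gen_KL_Pinsker fin sets)
qed

end
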